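(* The problem HittingSet over definable structures is undecidable: there is no algorithm which, given (finite presentations of) a definable set $P$ and a definable set $\mathcal{F}$ of subsets of $P$, decides whether there is a subset $Q\subseteq P$ such that $|Q\cap C|=1$ for every $C\in\mathcal{F}$.
   Context: Fix a countably infinite set $\mathbb{A}$ of atoms and an infinite set of atom variables. An expression is either a variable or a formal finite (possibly empty) union of set-builder expressions $\{e \mid x_1,\dots,x_k\in\mathbb{A},\ \varphi\}$ (with $k\ge 0$), where $e$ is an expression, the $x_i$ are bound variables, and $\varphi$ is a first-order formula over the atom variables with equality as the only relation symbol (interpreted in $(\mathbb{A},=)$). An expression $e$ with set of free variables $V$, together with a valuation $\sigma:V\to\mathbb{A}$, has a value $e[\sigma]$, defined in the obvious way by induction on $e$, which is an atom or a set; the sets arising this way are called definable. Pairs, tuples, integers, constants, disjoint unions etc. are encoded by standard set-theoretic means (e.g. $(x,y)=\{x,\{x,y\}\}$). A definable set is presented to an algorithm as a pair $(e,\sigma)$. The set $Q$ sought as a solution is arbitrary (not required to be definable). *)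

theory Defs
  imports "HOL-Library.Countable_Set_Type" "HOL-Library.Nat_Bijection"
begin

section \<open>Atoms, first-order formulas and set-builder expressions\<close>

text \<open>The countably infinite set of atoms is a copy of the natural numbers. The formulas below can
  only test atoms for equality; the numbering serves to write an atom down as input of an algorithm.\<close>

datatype atom = Atom (atom_index: nat)

type_synonym var = nat

text \<open>The remaining connectives, the universal quantifier and the truth values are definable from
  these.\<close>

datatype fm = Eq var var | Neg fm | Conj fm fm | Ex var fm

primrec sat :: "(var \<Rightarrow> atom) \<Rightarrow> fm \<Rightarrow> bool" where
  "sat \<sigma> (Eq x y) \<longleftrightarrow> \<sigma> x = \<sigma> y"
| "sat \<sigma> (Neg \<phi>) \<longleftrightarrow> \<not> sat \<sigma> \<phi>"
| "sat \<sigma> (Conj \<phi> \<psi>) \<longleftrightarrow> sat \<sigma> \<phi> \<and> sat \<sigma> \<psi>"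
| "sat \<sigma> (Ex x \<phi>) \<longleftrightarrow> (\<exists>a. sat (\<sigma>(x := a)) \<phi>)"

primrec fv_fm :: "fm \<Rightarrow> var set" where
  "fv_fm (Eq x y) = {x, y}"
| "fv_fm (Neg \<phi>) = fv_fm \<phi>"
| "fv_fm (Conj \<phi> \<psi>) = fv_fm \<phi> \<union> fv_fm \<psi>"
| "fv_fm (Ex x \<phi>) = fv_fm \<phi> - {x}"

text \<open>\<open>Builder e [x\<^sub>1, \<dots>, x\<^sub>k] \<phi>\<close> stands for
  \<open>{e | x\<^sub>1, \<dots>, x\<^sub>k \<in> \<bbbA>, \<phi>}\<close>, and \<open>EUnion\<close> for the formal union of finitely many of these.\<close>

datatype expr = EVar var | EUnion "builder list"
  and builder = Builder expr "var list" fm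

fun fv_expr :: "expr \<Rightarrow> var set"
  and fv_builder :: "builder \<Rightarrow> var set" where
  "fv_expr (EVar x) = {x}"
| "fv_expr (EUnion bs) = (\<Union>b\<in>set bs. fv_builder b)"
| "fv_builder (Builder e xs \<phi>) = (fv_expr e \<union> fv_fm \<phi>) - set xs"


section \<open>Values\<close>

text \<open>The universe of hereditarily countable sets over atoms. It contains every definable set, and
  with a set \<open>P\<close> it contains all subsets of \<open>P\<close>.\<close>

datatype val = At atom | St "val cset"

primrec elems :: "val \<Rightarrow> val set" where
  "elems (At a) = {}"
| "elems (St c) = rcset c"

definition is_set :: "val \<Rightarrow> bool" where
  "is_set v \<longleftrightarrow> (\<exists>c. v = St c)"

text \<open>Valuations are total here; only their values at the free variables matter
  (\<open>val_of_cong\<close> below). The argument of \<open>acset\<close> is always countable, so that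
  \<open>elems\<close> returns it unchanged (\<open>elems_val_of_EUnion\<close> below).\<close>

fun val_of :: "(var \<Rightarrow> atom) \<Rightarrow> expr \<Rightarrow> val"
  and members :: "(var \<Rightarrow> atom) \<Rightarrow> builder \<Rightarrow> val set" where
  "val_of \<sigma> (EVar x) = At (\<sigma> x)"
| "val_of \<sigma> (EUnion bs) = St (acset (\<Union>b\<in>set bs. members \<sigma> b))"
| "members \<sigma> (Builder e xs \<phi>) =
     {val_of \<tau> e | \<tau>. (\<forall>y. y \<notin> set xs \<longrightarrow> \<tau> y = \<sigma> y) \<and> sat \<tau> \<phi>}"

lemma countable_variants:
  fixes \<sigma> :: "var \<Rightarrow> atom"
  shows "countable {\<tau>. \<forall>y. y \<notin> set xs \<longrightarrow> \<tau> y = \<sigma> y}"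
proof (induction xs)
  case Nil
  have "{\<tau>. \<forall>y. y \<notin> set [] \<longrightarrow> \<tau> y = \<sigma> y} = {\<sigma>}" by auto
  then show ?case by simp
next
  case (Cons x xs)
  let ?V = "{\<tau>. \<forall>y. y \<notin> set xs \<longrightarrow> \<tau> y = \<sigma> y}"
  have "{\<tau>. \<forall>y. y \<notin> set (x # xs) \<longrightarrow> \<tau> y = \<sigma> y} \<subseteq> (\<lambda>(\<tau>, n). \<tau>(x := Atom n)) ` (?V \<times> UNIV)"
  proof
    fix \<tau> assume "\<tau> \<in> {\<tau>. \<forall>y. y \<notin> set (x # xs) \<longrightarrow> \<tau> y = \<sigma> y}"
    then have "\<tau>(x := \<sigma> x) \<in> ?V" by auto
    moreover have "\<tau> = (\<lambda>(\<tau>, n). \<tau>(x := Atom n)) (\<tau>(x := \<sigma> x), atom_index (\<tau> x))" by auto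
    ultimately show "\<tau> \<in> (\<lambda>(\<tau>, n). \<tau>(x := Atom n)) ` (?V \<times> UNIV)" by blast
  qed
  moreover have "countable ((\<lambda>(\<tau>, n). \<tau>(x := Atom n)) ` (?V \<times> (UNIV :: nat set)))"
    using Cons.IH by (intro countable_image countable_SIGMA) auto
  ultimately show ?case by (rule countable_subset)
qed

lemma countable_members: "countable (members \<sigma> b)"
proof (cases b)
  case (Builder e xs \<phi>)
  have "members \<sigma> b \<subseteq> (\<lambda>\<tau>. val_of \<tau> e) ` {\<tau>. \<forall>y. y \<notin> set xs \<longrightarrow> \<tau> y = \<sigma> y}"
    by (auto simp: Builder)
  then show ?thesis by (rule countable_subset) (intro countable_image countable_variants)
qed

lemma elems_val_of_EUnion: "elems (val_of \<sigma> (EUnion bs)) = (\<Union>b\<in>set bs. members \<sigma> b)"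
proof -
  have "countable (\<Union>b\<in>set bs. members \<sigma> b)"
    by (intro countable_UN countable_members) (simp add: countable_finite)
  then show ?thesis by (simp add: acset_inverse)
qed

lemma sat_cong: "(\<And>x. x \<in> fv_fm \<phi> \<Longrightarrow> \<sigma> x = \<tau> x) \<Longrightarrow> sat \<sigma> \<phi> \<longleftrightarrow> sat \<tau> \<phi>"
proof (induction \<phi> arbitrary: \<sigma> \<tau>)
  case (Eq x y)
  have "\<sigma> x = \<tau> x" "\<sigma> y = \<tau> y" by (rule Eq.prems, simp)+
  then show ?case by simp
next
  case (Neg \<phi>)
  have "sat \<sigma> \<phi> \<longleftrightarrow> sat \<tau> \<phi>" by (rule Neg.IH, rule Neg.prems) simp
  then show ?case by simp
next
  case (Conj \<phi> \<psi>)
  have "sat \<sigma> \<phi> \<longleftrightarrow> sat \<tau> \<phi>" by (rule Conj.IH(1), rule Conj.prems) simp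
  moreover have "sat \<sigma> \<psi> \<longleftrightarrow> sat \<tau> \<psi>" by (rule Conj.IH(2), rule Conj.prems) simp
  ultimately show ?case by simp
next
  case (Ex x \<phi>)
  have "sat (\<sigma>(x := a)) \<phi> \<longleftrightarrow> sat (\<tau>(x := a)) \<phi>" for a
  proof (rule Ex.IH)
    fix y assume y: "y \<in> fv_fm \<phi>"
    show "(\<sigma>(x := a)) y = (\<tau>(x := a)) y"
    proof (cases "y = x")
      case False
      then have "\<sigma> y = \<tau> y" by (intro Ex.prems) (simp add: y)
      with False show ?thesis by simp
    qed simp
  qed
  then show ?case by simp
qed

lemma val_of_cong: "(\<And>x. x \<in> fv_expr e \<Longrightarrow> \<sigma> x = \<tau> x) \<Longrightarrow> val_of \<sigma> e = val_of \<tau> e"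
  and members_cong: "(\<And>x. x \<in> fv_builder b \<Longrightarrow> \<sigma> x = \<tau> x) \<Longrightarrow> members \<sigma> b = members \<tau> b"
proof (induction e and b arbitrary: \<sigma> \<tau> and \<sigma> \<tau>)
  case (EVar x)
  then show ?case by simp
next
  case (EUnion bs)
  have "members \<sigma> b = members \<tau> b" if "b \<in> set bs" for b
  proof (rule EUnion.IH[OF that])
    fix x assume "x \<in> fv_builder b"
    then show "\<sigma> x = \<tau> x" using that by (intro EUnion.prems) auto
  qed
  then show ?case by simp
next
  case (Builder e xs \<phi>)
  have *: "members \<sigma> (Builder e xs \<phi>) \<subseteq> members \<tau> (Builder e xs \<phi>)"
    if st: "\<And>x. x \<in> fv_builder (Builder e xs \<phi>) \<Longrightarrow> \<sigma> x = \<tau> x" for \<sigma> \<tau>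
  proof
    fix v assume "v \<in> members \<sigma> (Builder e xs \<phi>)"
    then obtain \<rho> where \<rho>: "v = val_of \<rho> e" "\<And>y. y \<notin> set xs \<Longrightarrow> \<rho> y = \<sigma> y" "sat \<rho> \<phi>"
      by auto
    define \<rho>' where "\<rho>' y = (if y \<in> set xs then \<rho> y else \<tau> y)" for y
    have agree: "\<rho> y = \<rho>' y" if y: "y \<in> fv_expr e \<union> fv_fm \<phi>" for y
    proof (cases "y \<in> set xs")
      case False
      then have "y \<in> fv_builder (Builder e xs \<phi>)" using y by simp
      then have "\<sigma> y = \<tau> y" by (rule st)
      with \<rho>(2)[OF False] show ?thesis using False by (simp only: \<rho>'_def if_False)
    qed (simp only: \<rho>'_def if_True)
    have "val_of \<rho> e = val_of \<rho>' e" by (rule Builder.IH, rule agree) blast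
    with \<rho>(1) have v: "v = val_of \<rho>' e" by (rule trans)
    have "sat \<rho> \<phi> \<longleftrightarrow> sat \<rho>' \<phi>" by (rule sat_cong, rule agree) blast
    with \<rho>(3) have s: "sat \<rho>' \<phi>" by blast
    have "\<forall>y. y \<notin> set xs \<longrightarrow> \<rho>' y = \<tau> y" by (simp add: \<rho>'_def)
    with v s show "v \<in> members \<tau> (Builder e xs \<phi>)" unfolding members.simps by blast
  qed
  show ?case
  proof (rule subset_antisym)
    show "members \<sigma> (Builder e xs \<phi>) \<subseteq> members \<tau> (Builder e xs \<phi>)"
      by (rule *) (rule Builder.prems)
    show "members \<tau> (Builder e xs \<phi>) \<subseteq> members \<sigma> (Builder e xs \<phi>)"
      by (rule *) (rule Builder.prems[symmetric])
  qed
qed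


section \<open>Presentations\<close>

text \<open>An expression with a valuation of exactly its free variables, given as an association list.\<close>

type_synonym presentation = "expr \<times> (var \<times> atom) list"

definition wf_presentation :: "presentation \<Rightarrow> bool" where
  "wf_presentation p \<longleftrightarrow> distinct (map fst (snd p)) \<and> fst ` set (snd p) = fv_expr (fst p)"

definition denotes :: "presentation \<Rightarrow> val" where
  "denotes p = val_of (\<lambda>x. the (map_of (snd p) x)) (fst p)"


section \<open>The hitting set problem\<close>

definition is_hitting_set :: "val set \<Rightarrow> val \<Rightarrow> val \<Rightarrow> bool" where
  "is_hitting_set Q P F \<longleftrightarrow> Q \<subseteq> elems P \<and> (\<forall>C\<in>elems F. card (Q \<inter> elems C) = 1)"

definition hitting_set_instances :: "(presentation \<times> presentation) set" where
  "hitting_set_instances = {(p, f). wf_presentation p \<and> wf_presentation f \<and>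
     is_set (denotes p) \<and> is_set (denotes f) \<and>
     (\<forall>C\<in>elems (denotes f). is_set C \<and> elems C \<subseteq> elems (denotes p))}"

definition has_hitting_set :: "presentation \<times> presentation \<Rightarrow> bool" where
  "has_hitting_set = (\<lambda>(p, f). \<exists>Q. is_hitting_set Q (denotes p) (denotes f))"


section \<open>Coding of instances as natural numbers\<close>

primrec enc_fm :: "fm \<Rightarrow> nat" where
  "enc_fm (Eq x y) = prod_encode (0, prod_encode (x, y))"
| "enc_fm (Neg \<phi>) = prod_encode (1, enc_fm \<phi>)"
| "enc_fm (Conj \<phi> \<psi>) = prod_encode (2, prod_encode (enc_fm \<phi>, enc_fm \<psi>))"
| "enc_fm (Ex x \<phi>) = prod_encode (3, prod_encode (x, enc_fm \<phi>))"

fun enc_expr :: "expr \<Rightarrow> nat"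
  and enc_builder :: "builder \<Rightarrow> nat" where
  "enc_expr (EVar x) = prod_encode (0, x)"
| "enc_expr (EUnion bs) = prod_encode (1, list_encode (map enc_builder bs))"
| "enc_builder (Builder e xs \<phi>) =
     prod_encode (enc_expr e, prod_encode (list_encode xs, enc_fm \<phi>))"

definition enc_presentation :: "presentation \<Rightarrow> nat" where
  "enc_presentation p = prod_encode (enc_expr (fst p),
     list_encode (map (\<lambda>(x, a). prod_encode (x, atom_index a)) (snd p)))"

definition enc_instance :: "presentation \<times> presentation \<Rightarrow> nat" where
  "enc_instance i = prod_encode (enc_presentation (fst i), enc_presentation (snd i))"

lemma inj_enc_fm: "enc_fm \<phi> = enc_fm \<psi> \<Longrightarrow> \<phi> = \<psi>"
proof (induction \<phi> arbitrary: \<psi>)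
  case (Eq x y) then show ?case by (cases \<psi>) auto
next
  case (Neg \<phi>) then show ?case by (cases \<psi>) auto
next
  case (Conj \<phi> \<phi>') then show ?case by (cases \<psi>) auto
next
  case (Ex x \<phi>) then show ?case by (cases \<psi>) auto
qed

lemma inj_enc_expr: "enc_expr e = enc_expr e' \<Longrightarrow> e = e'"
  and inj_enc_builder: "enc_builder b = enc_builder b' \<Longrightarrow> b = b'"
proof (induction e and b arbitrary: e' and b')
  case (EVar x)
  then show ?case by (cases e') auto
next
  case (EUnion bs)
  then obtain bs' where e': "e' = EUnion bs'" by (cases e') auto
  with EUnion.prems have "map enc_builder bs = map enc_builder bs'"
    by (simp add: list_encode_eq)
  then have "bs = bs'"
    using EUnion.IH by (metis list.inj_map_strong)
  then show ?case using e' by simp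
next
  case (Builder e xs \<phi>)
  then show ?case by (cases b') (auto simp: list_encode_eq dest: inj_enc_fm)
qed

lemma inj_enc_instance: "inj enc_instance"
proof -
  have "inj (\<lambda>(x, a). prod_encode (x, atom_index a))"
    by (auto simp: inj_on_def atom.expand)
  then have "enc_presentation p = enc_presentation q \<Longrightarrow> p = q" for p q
    by (auto simp: enc_presentation_def list_encode_eq inj_map_eq_map
        intro!: prod_eqI dest: inj_enc_expr)
  then show ?thesis by (auto simp: inj_on_def enc_instance_def)
qed


section \<open>Algorithms: partial recursive functions\<close>

text \<open>Terms for Kleene's partial recursive functions. The arity is that of the argument list
  in \<open>computes\<close>; a term applied to a list of the wrong length may have no value.\<close>

datatype recf =
    Zero
  | Succ
  | Proj nat
  | Comp recf "recf list"
  | PrimRec recf recf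
  | Mu recf

inductive computes :: "recf \<Rightarrow> nat list \<Rightarrow> nat \<Rightarrow> bool" where
  zero: "computes Zero xs 0"
| succ: "computes Succ [x] (Suc x)"
| proj: "i < length xs \<Longrightarrow> computes (Proj i) xs (xs ! i)"
| comp: "list_all2 (\<lambda>g y. computes g xs y) gs ys \<Longrightarrow> computes f ys z \<Longrightarrow>
    computes (Comp f gs) xs z"
| prim_0: "computes f xs y \<Longrightarrow> computes (PrimRec f g) (0 # xs) y"
| prim_Suc: "computes (PrimRec f g) (n # xs) y \<Longrightarrow> computes g (n # y # xs) z \<Longrightarrow>
    computes (PrimRec f g) (Suc n # xs) z"
| mu: "computes f (n # xs) 0 \<Longrightarrow> (\<And>m. m < n \<Longrightarrow> \<exists>k. computes f (m # xs) (Suc k)) \<Longrightarrow>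
    computes (Mu f) xs n"

inductive_cases computes_cases:
  "computes Zero xs z" "computes Succ xs z" "computes (Proj i) xs z" "computes (Comp f gs) xs z"
  "computes (PrimRec f g) (0 # xs) z" "computes (PrimRec f g) (Suc n # xs) z" "computes (Mu f) xs z"

lemma computes_deterministic: "computes f xs y \<Longrightarrow> computes f xs z \<Longrightarrow> y = z"
proof (induction arbitrary: z rule: computes.induct)
  case (zero xs)
  then show ?case by (rule computes_cases(1)) simp
next
  case (succ x)
  then show ?case by (rule computes_cases(2)) simp
next
  case (proj i xs)
  from proj.prems show ?case by (rule computes_cases(3)) simp
next
  case (comp xs gs ys f v)
  from comp.prems obtain ys' where ys': "list_all2 (\<lambda>g y. computes g xs y) gs ys'" "computes f ys' z"
    by (rule computes_cases(4))
  have "ys = ys'"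
  proof (rule nth_equalityI)
    show "length ys = length ys'"
      using comp.IH(1) ys'(1) by (simp add: list_all2_conv_all_nth)
    fix i assume "i < length ys"
    then show "ys ! i = ys' ! i"
      using comp.IH(1) ys'(1) by (simp add: list_all2_conv_all_nth)
  qed
  then show ?case using comp.IH(2) ys'(2) by simp
next
  case (prim_0 f xs y g)
  from prim_0.prems have "computes f xs z" by (rule computes_cases(5))
  then show ?case by (rule prim_0.IH)
next
  case (prim_Suc f g n xs y v)
  from prim_Suc.prems obtain y' where y': "computes (PrimRec f g) (n # xs) y'" "computes g (n # y' # xs) z"
    by (rule computes_cases(6))
  from y'(1) have "y = y'" by (rule prim_Suc.IH(1))
  with y'(2) show ?case by (intro prim_Suc.IH(2)) simp
next
  case (mu f n xs)
  from mu.prems have z: "computes f (z # xs) 0" "\<And>m. m < z \<Longrightarrow> \<exists>k. computes f (m # xs) (Suc k)"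
    by (auto elim: computes_cases(7))
  show ?case
  proof (rule linorder_cases[of n z])
    assume "n < z"
    with z(2) obtain k where "computes f (n # xs) (Suc k)" by blast
    then have "0 = Suc k" by (rule mu.IH(1))
    then show ?thesis by simp
  next
    assume "z < n"
    with mu.IH(2) obtain k where "\<And>v. computes f (z # xs) v \<Longrightarrow> Suc k = v" by blast
    from this[OF z(1)] show ?thesis by simp
  qed
qed

text \<open>An algorithm is only required to halt with the correct answer on inputs from \<open>D\<close>;
  its behaviour on all other numbers is arbitrary.\<close>

definition decidable_on :: "'i set \<Rightarrow> ('i \<Rightarrow> nat) \<Rightarrow> ('i \<Rightarrow> bool) \<Rightarrow> bool" where
  "decidable_on D enc L \<longleftrightarrow> (\<exists>f. \<forall>i\<in>D. computes f [enc i] (if L i then 1 else 0))"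

end

theory Submission
  imports Defs
begin

text \<open>Exactly-one constraints over tuples of atoms express the existence of a countable model of a
  set of clauses: a tuple \<open>R(a)\<close> and its complement exclude each other, a clause is encoded by
  choosing one of its literals, and \<open>{S(a, b) | b \<in> \<bbbA>}\<close> makes \<open>S\<close> a total function. The evaluation
  of partial recursive functions is the least model of a finite set of Horn clauses over the
  natural numbers with successor \<open>S\<close>, so a hitting set exists iff the clauses together with
  the negation of ``program \<open>x\<close> returns 1 on input \<open>x\<close>'' are consistent, that is, iff program \<open>x\<close> does
  not return 1 on \<open>x\<close>. The numeral \<open>x\<close> enters through atoms \<open>c\<^sub>0, \<dots>, c\<^sub>x\<^sub>+\<^sub>5\<close> given by the valuation,
  with the facts \<open>S(c\<^sub>k, c\<^sub>k\<^sub>+\<^sub>1)\<close>; hence the instance is computable from \<open>x\<close>. Composing a decision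
  procedure with this map gives a program that contradicts itself on its own code.\<close>

section \<open>Tuples as values\<close>

definition vset :: "val set \<Rightarrow> val" where
  "vset A = St (acset A)"

lemma elems_vset [simp]: "countable A \<Longrightarrow> elems (vset A) = A"
  by (simp add: vset_def acset_inverse)

lemma vset_eq_iff: "countable A \<Longrightarrow> countable B \<Longrightarrow> vset A = vset B \<longleftrightarrow> A = B"
  by (metis elems_vset)

text \<open>Kuratowski's pair: unlike for \<open>{x, {x, y}}\<close>, its injectivity follows from
  extensionality alone, with no appeal to well-foundedness.\<close>

definition vpair :: "val \<Rightarrow> val \<Rightarrow> val" where
  "vpair x y = vset {vset {x}, vset {x, y}}"

lemma vpair_eq_iff [simp]: "vpair x y = vpair x' y' \<longleftrightarrow> x = x' \<and> y = y'"
  by (auto simp: vpair_def vset_eq_iff doubleton_eq_iff)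

lemma vpair_neq_empty [simp]: "vpair x y \<noteq> vset {}" "vset {} \<noteq> vpair x y"
  by (auto simp: vpair_def vset_eq_iff)

abbreviation vlist :: "val list \<Rightarrow> val" where
  "vlist vs \<equiv> foldr vpair vs (vset {})"

lemma vlist_eq_iff: "vlist us = vlist vs \<longleftrightarrow> us = vs"
proof (induction us arbitrary: vs)
  case Nil show ?case by (cases vs) auto
next
  case (Cons u us) then show ?case by (cases vs) auto
qed

section \<open>Relation symbols and tagged tuples of atoms\<close>

datatype relsym = RSuc | RPair | RCons | RComp | RAll | RPos | RNth | RGoal

type_synonym literal = "bool \<times> relsym \<times> var list"

instance relsym :: countable by countable_datatype

text \<open>\<open>Rel True r\<close> and \<open>Rel False r\<close> tag complementary elements; \<open>Aux c l\<close> marks \<open>l\<close> as the literal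
  chosen to make the clause \<open>c\<close> true; \<open>Dum c l\<close> turns an exactly-one constraint into an
  at-most-one constraint.\<close>

datatype tag = Rel bool relsym | Aux "literal list" literal | Dum "literal list" literal

instance tag :: countable by countable_datatype

text \<open>The tag is written in unary as a number of leading empty sets.\<close>

definition elt :: "tag \<times> atom list \<Rightarrow> val" where
  "elt = (\<lambda>(t, as). vlist (replicate (to_nat t) (vset {}) @ map At as))"

text \<open>Atoms are not sets, so the number of sets among the components recovers the tag; what
  follows the common prefix is the list of atoms.\<close>

lemma inj_elt: "inj elt"
proof (rule injI)
  fix x y assume eq: "elt x = elt y"
  obtain t as u bs where xy: "x = (t, as)" "y = (u, bs)" by (cases x, cases y)
  from eq have l: "replicate (to_nat t) (vset {}) @ map At as = replicate (to_nat u) (vset {}) @ map At bs"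
    by (simp only: xy elt_def prod.case vlist_eq_iff)
  have [simp]: "filter is_set (map At as) = []" "filter (\<lambda>v. \<not> is_set v) (map At as) = map At as" for as
    by (auto simp: is_set_def filter_empty_conv filter_id_conv)
  have [simp]: "is_set (vset {})" by (simp add: is_set_def vset_def)
  have "to_nat t = to_nat u"
    using arg_cong[OF l, of "\<lambda>xs. length (filter is_set xs)"] by (simp add: filter_replicate)
  moreover from this l have "as = bs" by (simp add: inj_map_eq_map inj_def)
  ultimately show "x = y" by (simp add: xy)
qed

section \<open>Expressions denoting tagged tuples\<close>

definition tru :: fm where "tru = Ex 0 (Eq 0 0)"

lemma tru_simps [simp]: "sat \<sigma> tru" "fv_fm tru = {}"
  by (auto simp: tru_def)

definition epair :: "expr \<Rightarrow> expr \<Rightarrow> expr" where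
  "epair e d = EUnion [Builder (EUnion [Builder e [] tru]) [] tru,
     Builder (EUnion [Builder e [] tru, Builder d [] tru]) [] tru]"

text \<open>With no bound variables the only admissible valuation is \<open>\<sigma>\<close> itself;
  \<open>epair\<close> lists finite sets as unions of such singletons.\<close>

lemma members_singleton: "members \<sigma> (Builder e [] tru) = {val_of \<sigma> e}"
proof -
  have "(\<forall>y. \<tau> y = \<sigma> y) \<longleftrightarrow> \<tau> = \<sigma>" for \<tau> by auto
  then show ?thesis by simp
qed

lemma val_of_epair [simp]: "val_of \<sigma> (epair e d) = vpair (val_of \<sigma> e) (val_of \<sigma> d)"
  by (simp add: epair_def vpair_def vset_def members_singleton insert_commute del: members.simps)

lemma fv_epair [simp]: "fv_expr (epair e d) = fv_expr e \<union> fv_expr d"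
  by (auto simp: epair_def)

definition eelt :: "tag \<Rightarrow> var list \<Rightarrow> expr" where
  "eelt t vs = foldr epair (replicate (to_nat t) (EUnion []) @ map EVar vs) (EUnion [])"

lemma val_of_eelt [simp]: "val_of \<sigma> (eelt t vs) = elt (t, map \<sigma> vs)"
proof -
  have "val_of \<sigma> (foldr epair es (EUnion [])) = vlist (map (val_of \<sigma>) es)" for es
    by (induction es) (auto simp: vset_def)
  then show ?thesis by (simp add: eelt_def elt_def vset_def comp_def del: foldr_append foldr_replicate)
qed

lemma fv_eelt [simp]: "fv_expr (eelt t vs) = set vs"
proof -
  have "fv_expr (foldr epair es (EUnion [])) = (\<Union>e\<in>set es. fv_expr e)" for es
    by (induction es) auto
  then show ?thesis by (auto simp: eelt_def simp del: foldr_append foldr_replicate)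
qed


section \<open>Exactly-one constraints\<close>

text \<open>Variables below \<open>nvars\<close> are universally quantified in a constraint; the variable \<open>nvars + k\<close> is
  a parameter, whose value is \<open>Atom k\<close>.\<close>

abbreviation nvars :: nat where "nvars \<equiv> 13"

text \<open>An item \<open>(ys, t, vs)\<close> contributes the elements with tag \<open>t\<close>
  and arguments \<open>vs\<close>, the variables \<open>ys\<close> running over all atoms. A list of
  items is a schema: for each assignment of the quantified variables, the union of its items is one
  constraint set.\<close>

type_synonym item = "var list \<times> tag \<times> var list"

fun item_elts :: "(var \<Rightarrow> atom) \<Rightarrow> item \<Rightarrow> (tag \<times> atom list) set" where
  "item_elts \<tau> (ys, t, vs) = {(t, map \<tau>' vs) |\<tau>'. \<forall>y. y \<notin> set ys \<longrightarrow> \<tau>' y = \<tau> y}"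

lemma item_elts_Nil [simp]: "item_elts \<tau> ([], t, vs) = {(t, map \<tau> vs)}"
proof -
  have "(\<forall>y. \<tau>' y = \<tau> y) \<longleftrightarrow> \<tau>' = \<tau>" for \<tau>' by auto
  then show ?thesis by simp
qed

declare item_elts.simps [simp del]

fun item_builder :: "item \<Rightarrow> builder" where
  "item_builder (ys, t, vs) = Builder (eelt t vs) ys tru"

lemma members_item_builder: "members \<sigma> (item_builder i) = elt ` item_elts \<sigma> i"
  by (cases i) (auto simp: item_elts.simps)

definition schema_elts :: "(var \<Rightarrow> atom) \<Rightarrow> item list \<Rightarrow> (tag \<times> atom list) set" where
  "schema_elts \<tau> s = (\<Union>i\<in>set s. item_elts \<tau> i)"

lemma schema_elts_simps [simp]:
  "schema_elts \<tau> [] = {}" "schema_elts \<tau> (i # s) = item_elts \<tau> i \<union> schema_elts \<tau> s"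
  by (auto simp: schema_elts_def)

definition schema_builder :: "item list \<Rightarrow> builder" where
  "schema_builder s = Builder (EUnion (map item_builder s)) [0..<nvars] tru"

definition params :: "var \<Rightarrow> atom" where "params v = Atom (v - nvars)"

definition good_env :: "(var \<Rightarrow> atom) \<Rightarrow> bool" where
  "good_env \<tau> \<longleftrightarrow> (\<forall>v\<ge>nvars. \<tau> v = params v)"

lemma members_schema_builder:
  "members params (schema_builder s) = {vset (elt ` schema_elts \<tau> s) |\<tau>. good_env \<tau>}"
  by (auto simp: schema_builder_def schema_elts_def good_env_def vset_def members_item_builder
      image_UN not_less)

lemma countable_schema_elts: "countable (elt ` schema_elts \<tau> s)"
  unfolding schema_elts_def image_UN members_item_builder[symmetric]
  by (intro countable_UN countable_members) (simp add: countable_finite)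

definition fexpr :: "item list list \<Rightarrow> expr" where
  "fexpr ss = EUnion (map schema_builder ss)"

text \<open>Only tag and length of an item are kept: with pairwise distinct bound variables every
  tuple of that length occurs, and the expression is closed.\<close>

definition pexpr :: "item list list \<Rightarrow> expr" where
  "pexpr ss = EUnion (map (\<lambda>(ys, t, vs). item_builder ([0..<length vs], t, [0..<length vs])) (concat ss))"

lemma elems_fexpr:
  "elems (val_of params (fexpr ss)) = {vset (elt ` schema_elts \<tau> s) |s \<tau>. s \<in> set ss \<and> good_env \<tau>}"
  unfolding fexpr_def elems_val_of_EUnion by (auto simp: members_schema_builder)

lemma elems_pexpr:
  assumes "s \<in> set ss" "(ys, t, vs) \<in> set s" "length as = length vs"
  shows "elt (t, as) \<in> elems (val_of \<sigma> (pexpr ss))"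
proof -
  let ?i = "([0..<length vs], t, [0..<length vs])"
  let ?\<tau> = "\<lambda>i. if i < length vs then as ! i else \<sigma> i"
  have "map ?\<tau> [0..<length vs] = as"
    using assms(3) by (intro nth_equalityI) auto
  then have "(t, as) \<in> item_elts \<sigma> ?i"
    by (auto simp: item_elts.simps intro!: exI[of _ ?\<tau>])
  then have "elt (t, as) \<in> members \<sigma> (item_builder ?i)"
    unfolding members_item_builder by blast
  then show ?thesis
    using assms(1,2) unfolding pexpr_def elems_val_of_EUnion
    by (intro UN_I[of "item_builder ?i"]) (auto intro!: image_eqI[of _ _ "(ys, t, vs)"])
qed

lemma card_eq_1_iff_ex1: "card A = 1 \<longleftrightarrow> (\<exists>!x. x \<in> A)"
  by (auto simp: card_1_singleton_iff)

text \<open>\<open>base\<close> only fixes the shapes of the elements available in \<open>P\<close>.\<close>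

definition covered :: "item list list \<Rightarrow> item list list \<Rightarrow> bool" where
  "covered base ss \<longleftrightarrow> (\<forall>s\<in>set ss. \<forall>(ys, t, vs)\<in>set s.
     \<exists>s'\<in>set base. \<exists>ys' vs'. (ys', t, vs') \<in> set s' \<and> length vs' = length vs)"

lemma schema_elts_subset_pexpr:
  assumes "covered base ss" "s \<in> set ss"
  shows "elt ` schema_elts \<tau> s \<subseteq> elems (val_of \<sigma> (pexpr base))"
proof
  fix v assume "v \<in> elt ` schema_elts \<tau> s"
  then obtain ys t vs \<tau>' where i: "(ys, t, vs) \<in> set s" "v = elt (t, map \<tau>' vs)"
    by (auto simp: schema_elts_def item_elts.simps)
  with assms obtain s' ys' vs' where "s' \<in> set base" "(ys', t, vs') \<in> set s'" "length vs' = length vs"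
    unfolding covered_def by blast
  then show "v \<in> elems (val_of \<sigma> (pexpr base))"
    unfolding i(2) by (intro elems_pexpr[of s' base ys' t vs']) auto
qed

section \<open>Hitting sets as predicates on tagged tuples\<close>

definition solves :: "(tag \<times> atom list \<Rightarrow> bool) \<Rightarrow> item list list \<Rightarrow> bool" where
  "solves q ss \<longleftrightarrow> (\<forall>s\<in>set ss. \<forall>\<tau>. good_env \<tau> \<longrightarrow> (\<exists>!e. e \<in> schema_elts \<tau> s \<and> q e))"

text \<open>Sets and predicates are translated along the injection \<open>elt\<close>, which
  preserves cardinality. Intersecting with \<open>?P\<close> secures the inclusion in
  \<open>P\<close> and, by \<open>covered\<close>, removes no element of any constraint.\<close>

lemma hitting_set_iff_solves:
  assumes "covered base ss"
  shows "(\<exists>Q. is_hitting_set Q (val_of \<sigma> (pexpr base)) (val_of params (fexpr ss))) \<longleftrightarrow> (\<exists>q. solves q ss)"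
proof -
  let ?P = "elems (val_of \<sigma> (pexpr base))"
  have card: "card (Q \<inter> elt ` schema_elts \<tau> s) = 1 \<longleftrightarrow> (\<exists>!e. e \<in> schema_elts \<tau> s \<and> q e)"
    if "\<And>e. e \<in> schema_elts \<tau> s \<Longrightarrow> elt e \<in> Q \<longleftrightarrow> q e" for Q q s \<tau>
  proof -
    have "Q \<inter> elt ` schema_elts \<tau> s = elt ` {e \<in> schema_elts \<tau> s. q e}"
      using that by auto
    then have "card (Q \<inter> elt ` schema_elts \<tau> s) = card {e \<in> schema_elts \<tau> s. q e}"
      by (simp add: card_image inj_on_subset[OF inj_elt])
    then show ?thesis by (simp only: card_eq_1_iff_ex1 mem_Collect_eq)
  qed
  have hit: "is_hitting_set Q (val_of \<sigma> (pexpr base)) (val_of params (fexpr ss)) \<longleftrightarrow>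
      Q \<subseteq> ?P \<and> (\<forall>s\<in>set ss. \<forall>\<tau>. good_env \<tau> \<longrightarrow> card (Q \<inter> elt ` schema_elts \<tau> s) = 1)" for Q
  proof -
    have "(\<forall>C\<in>{f s \<tau> |s \<tau>. s \<in> set ss \<and> good_env \<tau>}. R C) \<longleftrightarrow> (\<forall>s\<in>set ss. \<forall>\<tau>. good_env \<tau> \<longrightarrow> R (f s \<tau>))"
      for f :: "item list \<Rightarrow> (var \<Rightarrow> atom) \<Rightarrow> val" and R
      by blast
    then show ?thesis
      by (simp only: is_hitting_set_def elems_fexpr elems_vset[OF countable_schema_elts])
  qed
  show ?thesis
  proof
    assume "\<exists>Q. is_hitting_set Q (val_of \<sigma> (pexpr base)) (val_of params (fexpr ss))"
    then obtain Q where "is_hitting_set Q (val_of \<sigma> (pexpr base)) (val_of params (fexpr ss))" ..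
    then have "solves (\<lambda>e. elt e \<in> Q) ss"
      unfolding hit solves_def using card[of _ _ Q "\<lambda>e. elt e \<in> Q"] by blast
    then show "\<exists>q. solves q ss" by (rule exI[of "\<lambda>q. solves q ss"])
  next
    assume "\<exists>q. solves q ss"
    then obtain q where q: "solves q ss" ..
    let ?Q = "elt ` Collect q \<inter> ?P"
    have "card (?Q \<inter> elt ` schema_elts \<tau> s) = 1" if "s \<in> set ss" "good_env \<tau>" for s \<tau>
    proof -
      have "elt e \<in> ?Q \<longleftrightarrow> q e" if "e \<in> schema_elts \<tau> s" for e
        using that schema_elts_subset_pexpr[OF assms \<open>s \<in> set ss\<close>, of \<tau> \<sigma>] inj_elt
        by (auto dest: injD)
      then have "card (?Q \<inter> elt ` schema_elts \<tau> s) = 1 \<longleftrightarrow> (\<exists>!e. e \<in> schema_elts \<tau> s \<and> q e)"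
        by (rule card)
      with q that show ?thesis unfolding solves_def by blast
    qed
    then have "is_hitting_set ?Q (val_of \<sigma> (pexpr base)) (val_of params (fexpr ss))"
      unfolding hit by blast
    then show "\<exists>Q. is_hitting_set Q (val_of \<sigma> (pexpr base)) (val_of params (fexpr ss))" ..
  qed
qed


section \<open>Clauses\<close>

definition choice_schema :: "literal list \<Rightarrow> item list" where
  "choice_schema c = map (\<lambda>l. ([], Aux c l, [0..<nvars])) c"

text \<open>If \<open>Aux c l\<close> is selected, the complement of \<open>l\<close> is excluded,
  so \<open>l\<close> is true. Otherwise the complement takes its place when \<open>l\<close> is
  false, and \<open>Dum c l\<close> when \<open>l\<close> is true.\<close>

definition literal_schema :: "literal list \<Rightarrow> literal \<Rightarrow> item list" where
  "literal_schema c l = [([], Aux c l, [0..<nvars]),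
     ([], Rel (\<not> fst l) (fst (snd l)), snd (snd l)), ([], Dum c l, [0..<nvars])]"

definition clause_schemas :: "literal list \<Rightarrow> item list list" where
  "clause_schemas c = choice_schema c # map (literal_schema c) c"

primrec arity :: "relsym \<Rightarrow> nat" where
  "arity RSuc = 2" | "arity RPair = 3" | "arity RCons = 3" | "arity RComp = 3"
| "arity RAll = 3" | "arity RPos = 3" | "arity RNth = 3" | "arity RGoal = 1"

definition compl_schema :: "relsym \<Rightarrow> item list" where
  "compl_schema r = [([], Rel True r, [0..<arity r]), ([], Rel False r, [0..<arity r])]"

definition suc_schema :: "item list" where
  "suc_schema = [([1], Rel True RSuc, [0, 1])]"

definition rels :: "relsym list" where
  "rels = [RSuc, RPair, RCons, RComp, RAll, RPos, RNth, RGoal]"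

lemma set_rels: "r \<in> set rels"
  by (cases r) (auto simp: rels_def)

lemma arity_le: "arity r \<le> nvars"
  by (cases r) auto

section \<open>From solutions to true clauses\<close>

lemma good_env_extend:
  assumes "length as \<le> nvars"
  obtains \<tau> where "good_env \<tau>" "map \<tau> [0..<length as] = as"
proof
  show "good_env (\<lambda>i. if i < length as then as ! i else params i)"
    using assms by (auto simp: good_env_def)
qed (auto intro: nth_equalityI)

lemma compl_schemaD:
  assumes "solves q ss" "compl_schema r \<in> set ss" "length as = arity r"
  shows "q (Rel False r, as) \<longleftrightarrow> \<not> q (Rel True r, as)"
proof -
  have "length as \<le> nvars" using assms(3) arity_le[of r] by simp
  then obtain \<tau> where \<tau>: "good_env \<tau>" "map \<tau> [0..<length as] = as"
    by (rule good_env_extend)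
  have "schema_elts \<tau> (compl_schema r) = {(Rel True r, as), (Rel False r, as)}"
    using \<tau>(2) by (auto simp: compl_schema_def assms(3))
  moreover have "\<exists>!e. e \<in> schema_elts \<tau> (compl_schema r) \<and> q e"
    using assms(1,2) \<tau>(1) unfolding solves_def by blast
  ultimately show ?thesis by auto
qed

text \<open>The choice constraint singles out a literal, the constraint of that literal excludes its
  complement, and complementarity turns this into truth.\<close>

lemma clause_schemasD:
  assumes q: "solves q ss" and sub: "set (clause_schemas c) \<subseteq> set ss" "set (map compl_schema rels) \<subseteq> set ss"
    and ar: "\<forall>(b, r, vs)\<in>set c. length vs = arity r" and \<tau>: "good_env \<tau>"
  shows "\<exists>(b, r, vs)\<in>set c. q (Rel True r, map \<tau> vs) = b"
proof -
  have "choice_schema c \<in> set ss" using sub(1) by (simp add: clause_schemas_def)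
  then have "\<exists>!e. e \<in> schema_elts \<tau> (choice_schema c) \<and> q e"
    using q \<tau> unfolding solves_def by blast
  then obtain l where l: "l \<in> set c" "q (Aux c l, map \<tau> [0..<nvars])"
    by (auto simp: choice_schema_def schema_elts_def)
  obtain b r vs where l_eq: "l = (b, r, vs)" by (cases l)
  have "literal_schema c l \<in> set ss" using sub(1) l(1) by (auto simp: clause_schemas_def)
  then have "\<exists>!e. e \<in> schema_elts \<tau> (literal_schema c l) \<and> q e"
    using q \<tau> unfolding solves_def by blast
  then have "\<not> q (Rel (\<not> b) r, map \<tau> vs)"
    using l(2) by (auto simp: literal_schema_def l_eq)
  moreover have "q (Rel False r, map \<tau> vs) \<longleftrightarrow> \<not> q (Rel True r, map \<tau> vs)"
    using sub(2) set_rels[of r] ar l(1) by (intro compl_schemaD[OF q]) (auto simp: l_eq)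
  ultimately have "q (Rel True r, map \<tau> vs) = b" by (cases b) auto
  with l(1) l_eq show ?thesis by blast
qed

section \<open>From structures to solutions\<close>

definition env_of :: "atom list \<Rightarrow> var \<Rightarrow> atom" where
  "env_of as v = (if v < nvars then as ! v else params v)"

text \<open>\<open>Aux\<close> and \<open>Dum\<close> carry the values of all quantified variables,
  so the valuation at which a clause is read can be recovered from the element; this lets
  \<open>assignment\<close> make the same choice in all constraints of one clause instance.\<close>

lemma env_of_map: "good_env \<tau> \<Longrightarrow> env_of (map \<tau> [0..<nvars]) = \<tau>"
  by (rule ext) (simp add: env_of_def good_env_def del: upt_rec_numeral)

definition lit_true :: "(relsym \<Rightarrow> atom list \<Rightarrow> bool) \<Rightarrow> (var \<Rightarrow> atom) \<Rightarrow> literal \<Rightarrow> bool" where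
  "lit_true R \<tau> = (\<lambda>(b, r, vs). R r (map \<tau> vs) = b)"

definition chosen :: "(relsym \<Rightarrow> atom list \<Rightarrow> bool) \<Rightarrow> (var \<Rightarrow> atom) \<Rightarrow> literal list \<Rightarrow> literal" where
  "chosen R \<tau> c = (SOME l. l \<in> set c \<and> lit_true R \<tau> l)"

fun assignment :: "(relsym \<Rightarrow> atom list \<Rightarrow> bool) \<Rightarrow> tag \<times> atom list \<Rightarrow> bool" where
  "assignment R (Rel b r, as) \<longleftrightarrow> R r as = b"
| "assignment R (Aux c l, as) \<longleftrightarrow> l = chosen R (env_of as) c"
| "assignment R (Dum c l, as) \<longleftrightarrow> l \<noteq> chosen R (env_of as) c \<and> lit_true R (env_of as) l"

lemma solves_compl_schema: "solves (assignment R) [compl_schema r]"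
proof -
  have "\<exists>!e. e \<in> {(Rel False r, as), (Rel True r, as)} \<and> assignment R e" for as
    by (cases "R r as") auto
  then show ?thesis by (simp add: solves_def compl_schema_def)
qed

text \<open>In the constraint of a literal exactly one case applies: it is the chosen one
  (\<open>Aux\<close>), it is false (the complement), or it is true but not chosen
  (\<open>Dum\<close>). The first two exclude each other because the chosen literal is true.\<close>

lemma solves_clause_schemas:
  assumes "\<And>\<tau>. good_env \<tau> \<Longrightarrow> \<exists>l\<in>set c. lit_true R \<tau> l"
  shows "solves (assignment R) (clause_schemas c)"
  unfolding solves_def
proof (intro ballI allI impI)
  fix s \<tau> assume s: "s \<in> set (clause_schemas c)" and \<tau>: "good_env \<tau>"
  have "\<exists>l. l \<in> set c \<and> lit_true R \<tau> l" using assms[OF \<tau>] by blast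
  from someI_ex[OF this] have ch: "chosen R \<tau> c \<in> set c" "lit_true R \<tau> (chosen R \<tau> c)"
    unfolding chosen_def by blast+
  have cases: "s = choice_schema c \<or> (\<exists>l. s = literal_schema c l)"
    using s by (auto simp: clause_schemas_def)
  note env = env_of_map[OF \<tau>]
  from cases show "\<exists>!e. e \<in> schema_elts \<tau> s \<and> assignment R e"
  proof (elim disjE exE)
    assume "s = choice_schema c"
    then have "e \<in> schema_elts \<tau> s \<and> assignment R e \<longleftrightarrow> e = (Aux c (chosen R \<tau> c), map \<tau> [0..<nvars])" for e
      using ch(1) env by (cases e) (auto simp: choice_schema_def schema_elts_def simp del: upt_rec_numeral)
    then show ?thesis by simp
  next
    fix l assume "s = literal_schema c l"
    moreover obtain b r vs where l: "l = (b, r, vs)" by (cases l)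
    moreover have t: "lit_true R \<tau> l \<longleftrightarrow> R r (map \<tau> vs) = b" by (simp add: lit_true_def l)
    ultimately have elts: "e \<in> schema_elts \<tau> s \<and> assignment R e \<longleftrightarrow>
        (e = (Aux c l, map \<tau> [0..<nvars]) \<and> l = chosen R \<tau> c) \<or>
        (e = (Rel (\<not> b) r, map \<tau> vs) \<and> \<not> lit_true R \<tau> l) \<or>
        (e = (Dum c l, map \<tau> [0..<nvars]) \<and> l \<noteq> chosen R \<tau> c \<and> lit_true R \<tau> l)" for e
      using env by (cases e) (auto simp: literal_schema_def simp del: upt_rec_numeral)
    show ?thesis
    proof (cases "l = chosen R \<tau> c")
      case True
      with ch(2) show ?thesis unfolding elts by simp
    next
      case False
      then show ?thesis unfolding elts by (cases "lit_true R \<tau> l") simp_all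
    qed
  qed
qed


section \<open>A Horn theory of partial recursive functions\<close>

text \<open>A rule is a list of premises with a conclusion. The variables \<open>13, \<dots>, 18\<close> are parameters
  and stand for the numbers \<open>0, \<dots>, 5\<close>. The intended meanings of the relations are given by
  \<open>std\<close> below.\<close>

type_synonym rule = "(relsym \<times> var list) list \<times> relsym \<times> var list"

definition rules :: "rule list" where
  "rules = [
    ([], RPair, [13, 13, 13]),
    ([(RPair, [0, 1, 2]), (RSuc, [3, 1]), (RSuc, [0, 4]), (RSuc, [2, 5])], RPair, [4, 3, 5]),
    ([(RPair, [0, 13, 1]), (RSuc, [0, 2]), (RSuc, [1, 3])], RPair, [13, 2, 3]),
    ([(RPair, [0, 1, 2]), (RSuc, [2, 3])], RCons, [0, 1, 3]),
    ([(RPair, [13, 13, 0])], RComp, [0, 1, 13]),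
    ([(RPair, [14, 13, 0]), (RCons, [1, 13, 2]), (RSuc, [1, 3])], RComp, [0, 2, 3]),
    ([(RPair, [15, 0, 1]), (RNth, [0, 2, 3])], RComp, [1, 2, 3]),
    ([(RCons, [0, 1, 2])], RNth, [13, 2, 0]),
    ([(RNth, [0, 1, 2]), (RSuc, [0, 3]), (RCons, [4, 1, 5])], RNth, [3, 5, 2]),
    ([(RPair, [16, 0, 1]), (RPair, [2, 3, 0]), (RAll, [3, 4, 5]), (RComp, [2, 5, 6])],
      RComp, [1, 4, 6]),
    ([], RAll, [13, 0, 13]),
    ([(RComp, [0, 1, 2]), (RAll, [3, 1, 4]), (RCons, [0, 3, 5]), (RCons, [2, 4, 6])],
      RAll, [5, 1, 6]),
    ([(RPair, [17, 0, 1]), (RPair, [2, 3, 0]), (RComp, [2, 4, 5]), (RCons, [13, 4, 6])],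
      RComp, [1, 6, 5]),
    ([(RPair, [17, 0, 1]), (RPair, [2, 3, 0]), (RCons, [4, 5, 6]), (RComp, [1, 6, 7]),
      (RCons, [7, 5, 8]), (RCons, [4, 8, 9]), (RComp, [3, 9, 10]), (RSuc, [4, 11]),
      (RCons, [11, 5, 12])], RComp, [1, 12, 10]),
    ([(RPair, [18, 0, 1]), (RPos, [0, 2, 3]), (RCons, [2, 3, 4]), (RComp, [0, 4, 13])],
      RComp, [1, 3, 2]),
    ([], RPos, [0, 13, 1]),
    ([(RPos, [0, 1, 2]), (RCons, [1, 2, 3]), (RSuc, [4, 5]), (RComp, [0, 3, 5]), (RSuc, [1, 6])],
      RPos, [0, 6, 2]),
    ([(RCons, [0, 13, 1]), (RComp, [0, 1, 14])], RGoal, [0])]"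

section \<open>Program codes and the standard model of the rules\<close>

definition models :: "(relsym \<Rightarrow> nat list \<Rightarrow> bool) \<Rightarrow> bool" where
  "models H \<longleftrightarrow> (\<forall>bs r vs \<tau>. (bs, r, vs) \<in> set rules \<longrightarrow> (\<forall>k. \<tau> (nvars + k) = k) \<longrightarrow>
     (\<forall>(r', ws)\<in>set bs. H r' (map \<tau> ws)) \<longrightarrow> H r (map \<tau> vs))"

fun enc_recf :: "recf \<Rightarrow> nat" where
  "enc_recf Zero = prod_encode (0, 0)"
| "enc_recf Succ = prod_encode (1, 0)"
| "enc_recf (Proj i) = prod_encode (2, i)"
| "enc_recf (Comp f gs) = prod_encode (3, prod_encode (enc_recf f, list_encode (map enc_recf gs)))"
| "enc_recf (PrimRec f g) = prod_encode (4, prod_encode (enc_recf f, enc_recf g))"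
| "enc_recf (Mu f) = prod_encode (5, enc_recf f)"

lemma enc_recf_eq_iff [simp]: "enc_recf f = enc_recf g \<longleftrightarrow> f = g"
proof
  show "enc_recf f = enc_recf g \<Longrightarrow> f = g"
  proof (induction f arbitrary: g)
    case (Comp f gs)
    then obtain f' gs' where g: "g = Comp f' gs'" by (cases g) auto
    with Comp.prems have "enc_recf f = enc_recf f'" "map enc_recf gs = map enc_recf gs'"
      by (simp_all add: list_encode_eq)
    then show ?case using Comp.IH g by (metis list.inj_map_strong)
  next
    case Zero then show ?case by (cases g) auto
  next
    case Succ then show ?case by (cases g) auto
  next
    case (Proj i) then show ?case by (cases g) auto
  next
    case (PrimRec f1 f2) then show ?case by (cases g) auto
  next
    case (Mu f) then show ?case by (cases g) auto
  qed
qed simp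

text \<open>Quantifying over the programs coded by an argument makes the rules valid also for
  numbers that code no program.\<close>

primrec std :: "relsym \<Rightarrow> nat list \<Rightarrow> bool" where
  "std RSuc as \<longleftrightarrow> as ! 1 = Suc (as ! 0)"
| "std RPair as \<longleftrightarrow> as ! 2 = prod_encode (as ! 0, as ! 1)"
| "std RCons as \<longleftrightarrow> as ! 2 = Suc (prod_encode (as ! 0, as ! 1))"
| "std RComp as \<longleftrightarrow> (\<forall>f. as ! 0 = enc_recf f \<longrightarrow> computes f (list_decode (as ! 1)) (as ! 2))"
| "std RAll as \<longleftrightarrow> (\<forall>gs. as ! 0 = list_encode (map enc_recf gs) \<longrightarrow>
     list_all2 (\<lambda>g y. computes g (list_decode (as ! 1)) y) gs (list_decode (as ! 2)))"
| "std RPos as \<longleftrightarrow> (\<forall>f. as ! 0 = enc_recf f \<longrightarrow>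
     (\<forall>m < as ! 1. \<exists>k. computes f (m # list_decode (as ! 2)) (Suc k)))"
| "std RNth as \<longleftrightarrow> as ! 0 < length (list_decode (as ! 1)) \<and> as ! 2 = list_decode (as ! 1) ! (as ! 0)"
| "std RGoal as \<longleftrightarrow> (\<forall>f. as ! 0 = enc_recf f \<longrightarrow> computes f [as ! 0] 1)"

text \<open>Together with the value at \<open>(0, 0)\<close>, these equations define the graph of
  Cantor's pairing from the successor alone, walking along the antidiagonals; they are the first
  three rules.\<close>

lemma prod_encode_Suc: "prod_encode (Suc m, n) = Suc (prod_encode (m, Suc n))"
  "prod_encode (0, Suc m) = Suc (prod_encode (m, 0))"
  by (simp_all add: prod_encode_def)

lemma prod_encode_0_0: "prod_encode (0, 0) = 0"
  by (simp add: prod_encode_def)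

text \<open>The tags 0 to 5 are the numbers that the parameters 13 to 18 stand for, which is how a
  rule recognises the outermost constructor of a program.\<close>

lemma enc_recf_cases:
  "prod_encode (0, 0) = enc_recf f \<longleftrightarrow> f = Zero"
  "prod_encode (1, 0) = enc_recf f \<longleftrightarrow> f = Succ"
  "prod_encode (Suc 0, 0) = enc_recf f \<longleftrightarrow> f = Succ"
  "prod_encode (2, i) = enc_recf f \<longleftrightarrow> f = Proj i"
  "prod_encode (3, prod_encode (a, b)) = enc_recf f \<longleftrightarrow>
    (\<exists>g gs. f = Comp g gs \<and> a = enc_recf g \<and> b = list_encode (map enc_recf gs))"
  "prod_encode (4, prod_encode (a, b)) = enc_recf f \<longleftrightarrow>
    (\<exists>g h. f = PrimRec g h \<and> a = enc_recf g \<and> b = enc_recf h)"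
  "prod_encode (5, a) = enc_recf f \<longleftrightarrow> (\<exists>g. f = Mu g \<and> a = enc_recf g)"
  by (cases f; auto)+

lemma list_encode_map_cases:
  "0 = list_encode (map h xs) \<longleftrightarrow> xs = []"
  "Suc (prod_encode (a, b)) = list_encode (map h xs) \<longleftrightarrow>
    (\<exists>y ys. xs = y # ys \<and> a = h y \<and> b = list_encode (map h ys))"
  by (cases xs; auto)+

text \<open>For the rules concluding \<open>RComp\<close>, inverting the codes exposes the
  constructor of the program, and the matching introduction rule of \<open>computes\<close>
  applies.\<close>

lemma models_std: "models std"
  unfolding models_def
proof (intro allI impI)
  fix bs r vs and \<tau> :: "nat \<Rightarrow> nat"
  assume rule: "(bs, r, vs) \<in> set rules" and \<tau>: "\<forall>k. \<tau> (nvars + k) = k"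
    and prem: "\<forall>(r', ws)\<in>set bs. std r' (map \<tau> ws)"
  have [simp]: "\<tau> 13 = 0" "\<tau> 14 = 1" "\<tau> 15 = 2" "\<tau> 16 = 3" "\<tau> 17 = 4" "\<tau> 18 = 5"
    using \<tau>[rule_format, of 0] \<tau>[rule_format, of 1] \<tau>[rule_format, of 2] \<tau>[rule_format, of 3]
      \<tau>[rule_format, of 4] \<tau>[rule_format, of 5] by simp_all
  show "std r (map \<tau> vs)"
    using rule prem unfolding rules_def
    apply (simp only: list.set insert_iff empty_iff prod.inject simp_thms)
    apply (elim disjE conjE; hypsubst)
    \<comment> \<open>One goal per rule, in the order of \<open>rules\<close>.\<close>
    subgoal by (simp add: prod_encode_0_0)
    subgoal by (simp add: prod_encode_Suc)
    subgoal by (simp add: prod_encode_Suc)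
    subgoal by simp
    subgoal by (auto simp: enc_recf_cases intro: computes.intros)
    subgoal by (auto simp: enc_recf_cases intro: computes.intros)
    subgoal by (auto simp: enc_recf_cases intro: computes.intros)
    subgoal by simp
    subgoal by simp
    subgoal by (auto simp: enc_recf_cases intro: computes.intros)
    subgoal by (simp add: list_encode_map_cases)
    subgoal by (auto simp: list_encode_map_cases)
    subgoal by (auto simp: enc_recf_cases intro: computes.intros)
    subgoal by (auto simp: enc_recf_cases intro: computes.intros)
    subgoal by (auto simp: enc_recf_cases intro: computes.intros)
    subgoal by simp
    subgoal by (auto simp: less_Suc_eq)
    subgoal by auto
    done
qed

section \<open>Facts forced in every model of the rules\<close>

definition env :: "nat list \<Rightarrow> var \<Rightarrow> nat" where
  "env ns v = (if v < nvars then ns ! v else v - nvars)"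

text \<open>Instantiates a rule given by its position: \<open>ns\<close> lists the values of its
  variables from 0 on and may end with the last one that occurs in the rule, while
  \<open>env\<close> gives the parameters their numbers.\<close>

lemma modelsD:
  assumes "models H" "i < length rules"
    and prem: "list_all (\<lambda>(r, vs). H r (map (env ns) vs)) (fst (rules ! i))"
  shows "H (fst (snd (rules ! i))) (map (env ns) (snd (snd (rules ! i))))"
proof -
  obtain bs r vs where rule: "rules ! i = (bs, r, vs)" by (cases "rules ! i")
  with assms(2) have "(bs, r, vs) \<in> set rules" by (metis nth_mem)
  with assms(1) have "(\<forall>k. \<tau> (nvars + k) = k) \<longrightarrow> (\<forall>(r', ws)\<in>set bs. H r' (map \<tau> ws)) \<longrightarrow> H r (map \<tau> vs)"
    for \<tau> unfolding models_def by blast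
  from this[of "env ns"] prem show ?thesis
    by (simp add: rule env_def list_all_iff)
qed

context
  fixes H :: "relsym \<Rightarrow> nat list \<Rightarrow> bool"
  assumes H: "models H" and H_Suc: "\<And>n. H RSuc [n, Suc n]"
begin

text \<open>Induction on the code, which drops by one in each recursion equation of the
  pairing.\<close>

lemma models_pair: "H RPair [m, n, prod_encode (m, n)]"
proof (induction "prod_encode (m, n)" arbitrary: m n rule: less_induct)
  case less
  consider "m = 0" "n = 0" | k where "m = 0" "n = Suc k" | k where "m = Suc k"
    by (cases m; cases n) auto
  then show ?case
  proof cases
    case 1
    then show ?thesis using modelsD[OF H, of 0]
      by (simp add: rules_def env_def prod_encode_0_0)
  next
    case 2
    have "H RPair [k, 0, prod_encode (k, 0)]"
      using 2 by (intro less) (simp add: prod_encode_Suc)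
    then show ?thesis
      using 2 modelsD[OF H, of 2 "[k, prod_encode (k, 0), Suc k, Suc (prod_encode (k, 0))]"]
      by (simp add: rules_def env_def prod_encode_Suc H_Suc)
  next
    case 3
    have "H RPair [k, Suc n, prod_encode (k, Suc n)]"
      using 3 by (intro less) (simp add: prod_encode_Suc)
    then show ?thesis
      using 3 modelsD[OF H, of 1
        "[k, Suc n, prod_encode (k, Suc n), n, Suc k, Suc (prod_encode (k, Suc n))]"]
      by (simp add: rules_def env_def prod_encode_Suc H_Suc)
  qed
qed

lemma models_cons: "H RCons [m, n, Suc (prod_encode (m, n))]"
  using modelsD[OF H, of 3 "[m, n, prod_encode (m, n), Suc (prod_encode (m, n))]"]
  by (simp add: rules_def env_def models_pair H_Suc)

lemma models_nth: "i < length xs \<Longrightarrow> H RNth [i, list_encode xs, xs ! i]"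
proof (induction xs arbitrary: i)
  case (Cons x xs)
  show ?case
  proof (cases i)
    case 0
    then show ?thesis
      using modelsD[OF H, of 7 "[x, list_encode xs, list_encode (x # xs)]"]
      by (simp add: rules_def env_def models_cons)
  next
    case (Suc j)
    then show ?thesis
      using Cons modelsD[OF H, of 8 "[j, list_encode xs, xs ! j, Suc j, x, list_encode (x # xs)]"]
      by (simp add: rules_def env_def models_cons H_Suc)
  qed
qed simp

lemma models_all:
  assumes "list_all2 (\<lambda>g y. H RComp [enc_recf g, list_encode xs, y]) gs ys"
  shows "H RAll [list_encode (map enc_recf gs), list_encode xs, list_encode ys]"
  using assms
proof (induction rule: list_all2_induct)
  case Nil
  then show ?case
    using modelsD[OF H, of 10 "[list_encode xs]"] by (simp add: rules_def env_def)
next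
  case (Cons g gs y ys)
  then show ?case
    using modelsD[OF H, of 11 "[enc_recf g, list_encode xs, y, list_encode (map enc_recf gs),
      list_encode ys, list_encode (map enc_recf (g # gs)), list_encode (y # ys)]"]
    by (simp add: rules_def env_def models_cons)
qed

text \<open>Bounded quantification is not a Horn condition, so \<open>RPos\<close> gathers the
  positive values met by an unbounded search one at a time.\<close>

lemma models_pos:
  assumes "\<And>m. m < n \<Longrightarrow> \<exists>k. H RComp [enc_recf f, list_encode (m # xs), Suc k]"
  shows "H RPos [enc_recf f, n, list_encode xs]"
  using assms
proof (induction n)
  case 0
  then show ?case
    using modelsD[OF H, of 15 "[enc_recf f, list_encode xs]"] by (simp add: rules_def env_def)
next
  case (Suc n)
  obtain k where "H RComp [enc_recf f, list_encode (n # xs), Suc k]"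
    using Suc.prems by blast
  moreover have "H RPos [enc_recf f, n, list_encode xs]"
    using Suc.prems by (intro Suc.IH) simp
  ultimately show ?case
    using modelsD[OF H, of 16 "[enc_recf f, n, list_encode xs, list_encode (n # xs), k, Suc k, Suc n]"]
    by (simp add: rules_def env_def models_cons H_Suc)
qed

text \<open>Every introduction rule of \<open>computes\<close> is mirrored by a rule for
  \<open>RComp\<close>, so rule induction carries each true computation into an arbitrary
  model.\<close>

lemma models_computes: "computes f xs y \<Longrightarrow> H RComp [enc_recf f, list_encode xs, y]"
proof (induction rule: computes.induct)
  case (zero xs)
  then show ?case
    using modelsD[OF H, of 4 "[prod_encode (0, 0), list_encode xs]"]
    by (simp add: rules_def env_def models_pair)
next
  case (succ x)
  then show ?case
    using modelsD[OF H, of 5 "[prod_encode (1, 0), x, list_encode [x], Suc x]"]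
      models_pair[of 1 0] models_cons[of x 0]
    by (simp add: rules_def env_def H_Suc)
next
  case (proj i xs)
  then show ?case
    using modelsD[OF H, of 6 "[i, prod_encode (2, i), list_encode xs, xs ! i]"]
    by (simp add: rules_def env_def models_pair models_nth)
next
  case (comp xs gs ys f z)
  then have "H RAll [list_encode (map enc_recf gs), list_encode xs, list_encode ys]"
    by (intro models_all) (simp add: list_all2_conv_all_nth)
  with comp show ?case
    using modelsD[OF H, of 9 "[prod_encode (enc_recf f, list_encode (map enc_recf gs)),
      enc_recf (Comp f gs), enc_recf f, list_encode (map enc_recf gs), list_encode xs,
      list_encode ys, z]"]
    by (simp add: rules_def env_def models_pair)
next
  case (prim_0 f xs y g)
  then show ?case
    using modelsD[OF H, of 12 "[prod_encode (enc_recf f, enc_recf g), enc_recf (PrimRec f g),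
      enc_recf f, enc_recf g, list_encode xs, y, list_encode (0 # xs)]"]
    by (simp add: rules_def env_def models_pair models_cons)
next
  case (prim_Suc f g n xs y z)
  then show ?case
    using modelsD[OF H, of 13 "[prod_encode (enc_recf f, enc_recf g), enc_recf (PrimRec f g),
      enc_recf f, enc_recf g, n, list_encode xs, list_encode (n # xs), y, list_encode (y # xs),
      list_encode (n # y # xs), z, Suc n, list_encode (Suc n # xs)]"]
    by (simp add: rules_def env_def models_pair models_cons H_Suc)
next
  case (mu f n xs)
  then have "H RPos [enc_recf f, n, list_encode xs]"
    by (intro models_pos) blast
  with mu.IH(1) show ?case
    using modelsD[OF H, of 14 "[enc_recf f, enc_recf (Mu f), n, list_encode xs, list_encode (n # xs)]"]
    by (simp add: rules_def env_def models_pair models_cons)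
qed

lemma models_goal:
  assumes "computes f [enc_recf f] 1"
  shows "H RGoal [enc_recf f]"
  using models_computes[OF assms] modelsD[OF H, of 17 "[enc_recf f, list_encode [enc_recf f]]"]
    models_cons[of "enc_recf f" 0]
  by (simp add: rules_def env_def)

end


section \<open>The reduction\<close>

definition clause_of :: "rule \<Rightarrow> literal list" where
  "clause_of = (\<lambda>(bs, r, vs). (True, r, vs) # map (\<lambda>(r, vs). (False, r, vs)) bs)"

text \<open>The part that does not depend on the input; \<open>P\<close> is built from it
  alone.\<close>

definition base :: "item list list" where
  "base = suc_schema # map compl_schema rels @ concat (map (\<lambda>\<rho>. clause_schemas (clause_of \<rho>)) rules)"

definition fact_schema :: "nat \<Rightarrow> item list" where
  "fact_schema k = [([], Rel True RSuc, [nvars + k, nvars + Suc k])]"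

primrec facts :: "nat \<Rightarrow> item list list" where
  "facts 0 = []"
| "facts (Suc k) = fact_schema k # facts k"

definition goal_schema :: "nat \<Rightarrow> item list" where
  "goal_schema x = [([], Rel False RGoal, [nvars + x])]"

text \<open>The chain of facts reaches the number \<open>x + 5\<close> and thereby names both the
  constants 0 to 5 of the rules and the input \<open>x\<close>.\<close>

definition schemas :: "nat \<Rightarrow> item list list" where
  "schemas x = goal_schema x # facts (x + 5) @ base"

section \<open>Correctness of the reduction\<close>

lemma schema_elts_suc_schema:
  "schema_elts \<tau> suc_schema = range (\<lambda>b. (Rel True RSuc, [\<tau> 0, b]))"
proof -
  have "(Rel True RSuc, [\<tau> 0, b]) \<in> item_elts \<tau> ([1], Rel True RSuc, [0, 1])" for b
    unfolding item_elts.simps by (intro CollectI exI[of _ "\<tau>(1 := b)"]) simp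
  moreover have "item_elts \<tau> ([1], Rel True RSuc, [0, 1]) \<subseteq> range (\<lambda>b. (Rel True RSuc, [\<tau> 0, b]))"
    by (auto simp: item_elts.simps)
  ultimately show ?thesis by (auto simp: suc_schema_def)
qed

lemma set_facts: "set (facts n) = fact_schema ` {..<n}"
  by (induction n) (auto simp: lessThan_Suc)

lemma rules_wf:
  assumes "\<rho> \<in> set rules" "(b, r, vs) \<in> set (clause_of \<rho>)"
  shows "length vs = arity r" "set vs \<subseteq> {..18}"
proof -
  have "\<forall>\<rho>\<in>set rules. \<forall>(b, r, vs)\<in>set (clause_of \<rho>). length vs = arity r \<and> set vs \<subseteq> {..18}"
    by (simp add: rules_def clause_of_def)
  from bspec[OF bspec[OF this assms(1)] assms(2)]
  show "length vs = arity r" "set vs \<subseteq> {..18}" by simp_all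
qed

lemma base_mem: "suc_schema \<in> set base" "compl_schema r \<in> set base"
  "\<rho> \<in> set rules \<Longrightarrow> set (clause_schemas (clause_of \<rho>)) \<subseteq> set base"
  using set_rels by (auto simp: base_def)

lemma covered_schemas: "covered base (schemas x)"
proof -
  have "([1], Rel True RSuc, [0, 1]) \<in> set suc_schema"
    "([], Rel False RGoal, [0..<1]) \<in> set (compl_schema RGoal)"
    by (simp_all add: suc_schema_def compl_schema_def)
  with base_mem have c: "\<exists>s'\<in>set base. \<exists>ys' vs'. (ys', Rel True RSuc, vs') \<in> set s' \<and> length vs' = Suc (Suc 0)"
    "\<exists>s'\<in>set base. \<exists>ys' vs'. (ys', Rel False RGoal, vs') \<in> set s' \<and> length vs' = Suc 0"
    by fastforce+
  have "covered base [fact_schema k]" "covered base [goal_schema x]" for k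
    using c by (simp_all add: covered_def fact_schema_def goal_schema_def)
  moreover have "covered base [s]" if "s \<in> set base" for s
    using that unfolding covered_def by fastforce
  ultimately have "covered base [s]" if "s \<in> set (schemas x)" for s
    using that unfolding schemas_def by (auto simp only: set_simps set_append set_facts)
  then show ?thesis by (simp add: covered_def)
qed

text \<open>A solution makes successor a total function on atoms. Iterating it from
  \<open>Atom 0\<close> gives a map \<open>h\<close> from numbers to atoms; the relations pulled
  back along \<open>h\<close> form a model of the rules and hence contain the goal fact that
  \<open>goal_schema\<close> denies.\<close>

lemma solves_schemas_imp_not_computes:
  assumes q: "solves q (schemas (enc_recf f))"
  shows "\<not> computes f [enc_recf f] 1"
proof
  assume comp: "computes f [enc_recf f] 1"
  define x where "x = enc_recf f"
  have sub: "set base \<subseteq> set (schemas x)" by (auto simp: schemas_def)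
  have q': "\<exists>!e. e \<in> schema_elts \<tau> s \<and> q e" if "s \<in> set (schemas x)" "good_env \<tau>" for s \<tau>
    using q that by (auto simp: solves_def x_def)
  have params: "good_env params" by (simp add: good_env_def)
  have suc: "\<exists>!b. q (Rel True RSuc, [a, b])" for a
  proof -
    let ?\<tau> = "\<lambda>v. if v = 0 then a else params v"
    have "good_env ?\<tau>" by (simp add: good_env_def)
    then have "\<exists>!e. e \<in> range (\<lambda>b. (Rel True RSuc, [a, b])) \<and> q e"
      using q'[of suc_schema ?\<tau>] sub base_mem(1) by (auto simp: schema_elts_suc_schema)
    then show ?thesis by auto
  qed
  define h where "h = rec_nat (Atom 0) (\<lambda>_ a. THE b. q (Rel True RSuc, [a, b]))"
  have h_0: "h 0 = Atom 0" by (simp add: h_def)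
  have h_Suc: "q (Rel True RSuc, [h n, h (Suc n)])" for n
    using theI'[OF suc[of "h n"]] by (simp add: h_def)
  have fact: "q (Rel True RSuc, [Atom k, Atom (Suc k)])" if "k < x + 5" for k
  proof -
    have "fact_schema k \<in> set (schemas x)" using that by (auto simp: schemas_def set_facts)
    from q'[OF this params] show ?thesis by (auto simp: fact_schema_def params_def)
  qed
  \<comment> \<open>Uniqueness of successors keeps \<open>h\<close> on the chain of
    parameters.\<close>
  have h_Atom: "k \<le> x + 5 \<Longrightarrow> h k = Atom k" for k
  proof (induction k)
    case (Suc k)
    then have "q (Rel True RSuc, [Atom k, h (Suc k)])" using h_Suc[of k] by simp
    moreover have "q (Rel True RSuc, [Atom k, Atom (Suc k)])" using Suc.prems by (intro fact) simp
    ultimately show ?case using suc by blast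
  qed (rule h_0)
  \<comment> \<open>\<open>h\<close> may identify different numbers, but universally quantified
    clauses stay true under pulling back.\<close>
  define H where "H r ns = q (Rel True r, map h ns)" for r ns
  have "models H"
    unfolding models_def
  proof (intro allI impI)
    fix bs r vs and \<tau> :: "nat \<Rightarrow> nat"
    assume rule: "(bs, r, vs) \<in> set rules" and \<tau>: "\<forall>k. \<tau> (nvars + k) = k"
      and prem: "\<forall>(r', ws)\<in>set bs. H r' (map \<tau> ws)"
    \<comment> \<open>\<open>good_env\<close> fixes the parameters; up to variable 18, the last one
      in the rules, their values agree with \<open>h\<close> by \<open>h_Atom\<close>.\<close>
    define \<tau>' where "\<tau>' v = (if v < nvars then h (\<tau> v) else params v)" for v
    have "\<tau>' v = h (\<tau> v)" if "v \<le> 18" for v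
    proof (cases "v < nvars")
      case False
      then have "\<tau> v = v - nvars" using \<tau>[rule_format, of "v - nvars"] by simp
      with False that show ?thesis by (simp add: \<tau>'_def params_def h_Atom)
    qed (simp add: \<tau>'_def)
    then have eq: "map \<tau>' ws = map h (map \<tau> ws)" if "(b, r', ws) \<in> set (clause_of (bs, r, vs))" for b r' ws
      using rules_wf(2)[OF rule that] by auto
    have "\<exists>(b, r', ws)\<in>set (clause_of (bs, r, vs)). q (Rel True r', map \<tau>' ws) = b"
    proof (rule clause_schemasD)
      show "solves q (schemas x)" using q by (simp add: x_def)
      show "set (clause_schemas (clause_of (bs, r, vs))) \<subseteq> set (schemas x)"
        using base_mem(3)[OF rule] sub by blast
      show "set (map compl_schema rels) \<subseteq> set (schemas x)"
        using base_mem(2) sub by auto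
      show "\<forall>(b, r', ws)\<in>set (clause_of (bs, r, vs)). length ws = arity r'"
        using rules_wf(1)[OF rule] by auto
      show "good_env \<tau>'" by (simp add: good_env_def \<tau>'_def)
    qed
    then obtain b r' ws where l: "(b, r', ws) \<in> set (clause_of (bs, r, vs))"
      "q (Rel True r', map \<tau>' ws) = b" by auto
    then have "H r' (map \<tau> ws) = b" using eq[OF l(1)] by (simp only: H_def)
    \<comment> \<open>All premises hold in \<open>H\<close>, so the true literal cannot be a negated
      premise and must be the conclusion.\<close>
    with l(1) show "H r (map \<tau> vs)" using prem by (auto simp: clause_of_def)
  qed
  moreover have "H RSuc [n, Suc n]" for n by (simp add: H_def h_Suc)
  ultimately have "H RGoal [x]" unfolding x_def using comp by (rule models_goal)
  then have "q (Rel True RGoal, [Atom x])" by (simp add: H_def h_Atom)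
  moreover have "q (Rel False RGoal, [Atom x])"
  proof -
    have "goal_schema x \<in> set (schemas x)" by (simp add: schemas_def)
    from q'[OF this params] show ?thesis by (auto simp: goal_schema_def params_def)
  qed
  moreover have "q (Rel False RGoal, [Atom x]) \<longleftrightarrow> \<not> q (Rel True RGoal, [Atom x])"
    using q sub base_mem(2) by (intro compl_schemaD) (auto simp: x_def)
  ultimately show False by blast
qed

text \<open>The standard model is transported to the atoms by their numbering, so that
  \<open>Atom k\<close> plays the number \<open>k\<close>; the goal fact is false in it by
  assumption.\<close>

lemma not_computes_imp_solves_schemas:
  assumes "\<not> computes f [enc_recf f] 1"
  shows "\<exists>q. solves q (schemas (enc_recf f))"
proof -
  define R where "R r as = std r (map atom_index as)" for r as
  have "\<exists>!e. e \<in> schema_elts \<tau> s \<and> assignment R e"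
    if \<tau>: "good_env \<tau>" and s: "s \<in> set (schemas (enc_recf f))" for \<tau> s
  proof -
    have tau: "\<tau> (nvars + k) = Atom k" for k
      using \<tau> by (simp add: good_env_def params_def)
    consider "s = suc_schema" | r where "s = compl_schema r"
      | \<rho> where "\<rho> \<in> set rules" "s \<in> set (clause_schemas (clause_of \<rho>))"
      | k where "s = fact_schema k" | "s = goal_schema (enc_recf f)"
      using s by (auto simp: schemas_def base_def set_facts)
    then show ?thesis
    proof cases
      case 1
      have "assignment R (Rel True RSuc, [\<tau> 0, b]) \<longleftrightarrow> b = Atom (Suc (atom_index (\<tau> 0)))" for b
        by (cases b) (simp add: R_def)
      then show ?thesis unfolding 1 schema_elts_suc_schema by auto
    next
      case 2
      then show ?thesis using solves_compl_schema[of R r] \<tau> by (simp add: solves_def)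
    next
      case 3
      have "\<exists>l\<in>set (clause_of \<rho>). lit_true R \<tau>' l" if \<tau>': "good_env \<tau>'" for \<tau>'
      proof -
        obtain bs r vs where \<rho>: "\<rho> = (bs, r, vs)" by (cases \<rho>)
        have "(atom_index \<circ> \<tau>') (nvars + k) = k" for k
          using \<tau>' by (simp add: good_env_def params_def)
        with 3(1) models_std have "(\<forall>(r', ws)\<in>set bs. R r' (map \<tau>' ws)) \<longrightarrow> R r (map \<tau>' vs)"
          unfolding models_def R_def \<rho> map_map by blast
        then show ?thesis by (fastforce simp: clause_of_def \<rho> lit_true_def)
      qed
      from solves_clause_schemas[OF this] 3(2) \<tau> show ?thesis by (simp add: solves_def)
    next
      case (4 k)
      have "std RSuc [k, Suc k]" by simp
      then show ?thesis using tau[of k] tau[of "Suc k"] by (auto simp: 4 fact_schema_def R_def)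
    next
      case 5
      \<comment> \<open>By injectivity of \<open>enc_recf\<close>, \<open>f\<close> is the only
        program with this code.\<close>
      have "\<not> std RGoal [enc_recf f]" using assms by simp
      then show ?thesis using tau[of "enc_recf f"] by (auto simp: 5 goal_schema_def R_def)
    qed
  qed
  then have "solves (assignment R) (schemas (enc_recf f))"
    unfolding solves_def by blast
  then show ?thesis by blast
qed

section \<open>The instance and its presentation\<close>

primrec valuation :: "nat \<Rightarrow> (var \<times> atom) list" where
  "valuation 0 = []"
| "valuation (Suc k) = (nvars + k, Atom k) # valuation k"

text \<open>The \<open>x + 5\<close> facts mention \<open>x + 6\<close> parameters; \<open>P\<close>
  is closed and gets the empty valuation.\<close>

definition inst :: "nat \<Rightarrow> presentation \<times> presentation" where
  "inst x = ((pexpr base, []), (fexpr (schemas x), valuation (x + 6)))"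

lemma fst_valuation: "fst ` set (valuation n) = {nvars..<nvars + n}"
  by (induction n) (auto simp: image_Un)

lemma distinct_valuation: "distinct (map fst (valuation n))"
  by (induction n) (use fst_valuation in auto)

lemma map_of_valuation: "v \<in> {nvars..<nvars + n} \<Longrightarrow> map_of (valuation n) v = Some (params v)"
  by (induction n) (auto simp: params_def)

lemma fv_schema_builder:
  "fv_builder (schema_builder s) = (\<Union>(ys, t, vs)\<in>set s. set vs - set ys) - {..<nvars}"
  by (auto simp: schema_builder_def)

lemma fv_pexpr: "fv_expr (pexpr ss) = {}"
  by (auto simp: pexpr_def)

lemma fv_base: "s \<in> set base \<Longrightarrow> fv_builder (schema_builder s) \<subseteq> {nvars..18}"
proof -
  assume "s \<in> set base"
  then consider "s = suc_schema" | r where "s = compl_schema r"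
    | \<rho> where "\<rho> \<in> set rules" "s \<in> set (clause_schemas (clause_of \<rho>))"
    by (auto simp: base_def)
  then show ?thesis
  proof cases
    case 1 then show ?thesis by (auto simp: fv_schema_builder suc_schema_def)
  next
    case 2 then show ?thesis using arity_le[of r] by (auto simp: fv_schema_builder compl_schema_def)
  next
    case 3
    then show ?thesis
      using rules_wf(2)[OF 3(1)]
      by (fastforce simp: fv_schema_builder clause_schemas_def choice_schema_def literal_schema_def
          simp del: upt_rec_numeral)
  qed
qed

text \<open>A presentation must value exactly its free variables. The facts alone mention all these
  parameters, and those of the goal and of \<open>base\<close> lie among them.\<close>

lemma fv_fexpr_schemas: "fv_expr (fexpr (schemas x)) = {nvars..<nvars + (x + 6)}"
proof -
  have "(\<Union>s\<in>set (facts (x + 5)). fv_builder (schema_builder s)) = {nvars..<nvars + (x + 6)}"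
  proof -
    \<comment> \<open>The case \<open>n = 0\<close> is separate because the interval on the right
      would still contain \<open>nvars\<close>.\<close>
    have union: "(\<Union>k<n. {nvars + k, nvars + Suc k}) = (if n = 0 then {} else {nvars..<nvars + Suc n})" for n
      by (induction n) (auto simp: lessThan_Suc)
    have "fv_builder (schema_builder (fact_schema k)) = {nvars + k, nvars + Suc k}" for k
      by (auto simp: fv_schema_builder fact_schema_def)
    then have "(\<Union>s\<in>set (facts (x + 5)). fv_builder (schema_builder s)) = (\<Union>k<x + 5. {nvars + k, nvars + Suc k})"
      by (simp only: set_facts image_image)
    also have "\<dots> = {nvars..<nvars + (x + 6)}"
      unfolding union by simp
    finally show ?thesis .
  qed
  moreover have "fv_builder (schema_builder (goal_schema x)) = {nvars + x}"
    by (auto simp: fv_schema_builder goal_schema_def)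
  moreover have "(\<Union>s\<in>set base. fv_builder (schema_builder s)) \<subseteq> {nvars..<nvars + (x + 6)}"
    using fv_base by fastforce
  ultimately show ?thesis by (auto simp: fexpr_def schemas_def)
qed

lemma denotes_inst: "denotes (snd (inst x)) = val_of params (fexpr (schemas x))"
  unfolding denotes_def inst_def snd_conv fst_conv
  by (rule val_of_cong) (simp only: fv_fexpr_schemas map_of_valuation option.sel)

lemma inst_mem: "inst x \<in> hitting_set_instances"
proof -
  have "is_set (denotes (fst (inst x)))" "is_set (denotes (snd (inst x)))"
    by (auto simp: denotes_inst is_set_def fexpr_def) (auto simp: inst_def denotes_def pexpr_def)
  moreover have "is_set C \<and> elems C \<subseteq> elems (denotes (fst (inst x)))"
    if "C \<in> elems (denotes (snd (inst x)))" for C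
  proof -
    from that obtain s \<tau> where "s \<in> set (schemas x)" "C = vset (elt ` schema_elts \<tau> s)"
      by (auto simp: denotes_inst elems_fexpr)
    then show ?thesis
      using schema_elts_subset_pexpr[OF covered_schemas]
      by (simp add: countable_schema_elts is_set_def vset_def[of "elt ` _"] inst_def denotes_def
          acset_inverse)
  qed
  moreover have "wf_presentation (fst (inst x))" "wf_presentation (snd (inst x))"
    by (simp_all only: wf_presentation_def inst_def fst_conv snd_conv fv_pexpr fv_fexpr_schemas
        fst_valuation distinct_valuation) simp_all
  ultimately show ?thesis
    by (simp add: hitting_set_instances_def case_prod_beta)
qed

lemma has_hitting_set_inst:
  "has_hitting_set (inst (enc_recf f)) \<longleftrightarrow> \<not> computes f [enc_recf f] 1"
proof -
  have "has_hitting_set (inst x) \<longleftrightarrow> (\<exists>q. solves q (schemas x))" for x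
    using hitting_set_iff_solves[OF covered_schemas] denotes_inst[of x]
    by (simp add: has_hitting_set_def case_prod_beta inst_def denotes_def)
  then show ?thesis
    using solves_schemas_imp_not_computes not_computes_imp_solves_schemas by blast
qed


section \<open>Computability of the reduction\<close>

definition computable :: "nat \<Rightarrow> (nat list \<Rightarrow> nat) \<Rightarrow> bool" where
  "computable n g \<longleftrightarrow> (\<exists>f. \<forall>xs. length xs = n \<longrightarrow> computes f xs (g xs))"

section \<open>Closure properties of total computable functions\<close>

lemma computable_const: "computable n (\<lambda>_. c)"
proof (induction c)
  case 0
  show ?case unfolding computable_def by (rule exI[of _ Zero]) (simp add: computes.intros)
next
  case (Suc c)
  then obtain f where "\<forall>xs. length xs = n \<longrightarrow> computes f xs c" by (auto simp: computable_def)
  then show ?case unfolding computable_def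
    by (intro exI[of _ "Comp Succ [f]"]) (auto intro!: computes.intros(4)[of _ _ "[c]"] computes.intros)
qed

lemma computable_nth: "i < n \<Longrightarrow> computable n (\<lambda>xs. xs ! i)"
  unfolding computable_def by (rule exI[of _ "Proj i"]) (simp add: computes.intros)

lemma computable_comp1:
  assumes "computable 1 g" "computable n h"
  shows "computable n (\<lambda>xs. g [h xs])"
proof -
  obtain fg fh where "\<And>xs. length xs = 1 \<Longrightarrow> computes fg xs (g xs)"
    "\<And>xs. length xs = n \<Longrightarrow> computes fh xs (h xs)"
    using assms by (auto simp: computable_def)
  then show ?thesis unfolding computable_def
    by (intro exI[of _ "Comp fg [fh]"]) (auto intro!: computes.intros(4)[of _ _ "[h xs]" for xs])
qed

lemma computable_comp2:
  assumes "computable 2 g" "computable n h" "computable n k"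
  shows "computable n (\<lambda>xs. g [h xs, k xs])"
proof -
  obtain fg fh fk where "\<And>xs. length xs = 2 \<Longrightarrow> computes fg xs (g xs)"
    "\<And>xs. length xs = n \<Longrightarrow> computes fh xs (h xs)" "\<And>xs. length xs = n \<Longrightarrow> computes fk xs (k xs)"
    using assms by (auto simp: computable_def)
  then show ?thesis unfolding computable_def
    by (intro exI[of _ "Comp fg [fh, fk]"]) (auto intro!: computes.intros(4)[of _ _ "[h xs, k xs]" for xs])
qed

lemma computable_Suc:
  assumes "computable n g" shows "computable n (\<lambda>xs. Suc (g xs))"
proof -
  have "computable 1 (\<lambda>xs. Suc (hd xs))"
    unfolding computable_def
    by (rule exI[of _ Succ]) (auto simp: length_Suc_conv intro: computes.intros)
  from computable_comp1[OF this assms] show ?thesis by simp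
qed

text \<open>The constant start value is given by a program without arguments; \<open>h\<close>
  supplies the number of steps by composition.\<close>

lemma computable_rec_nat:
  assumes "computable 2 (\<lambda>xs. g (xs ! 0) (xs ! 1))" "computable n h"
  shows "computable n (\<lambda>xs. rec_nat c g (h xs))"
proof -
  obtain fg fc where f: "\<And>xs. length xs = 2 \<Longrightarrow> computes fg xs (g (xs ! 0) (xs ! 1))"
    "computes fc [] c"
    using assms(1) computable_const[of 0 c] by (auto simp: computable_def)
  have "computes (PrimRec fc fg) [m] (rec_nat c g m)" for m
  proof (induction m)
    case (Suc m)
    then show ?case using f(1)[of "[m, rec_nat c g m]"] by (auto intro: computes.intros)
  qed (auto intro: f computes.intros)
  then have "computable 1 (\<lambda>xs. rec_nat c g (xs ! 0))"
    unfolding computable_def by (intro exI[of _ "PrimRec fc fg"]) (auto simp: length_Suc_conv)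
  from computable_comp1[OF this assms(2)] show ?thesis by simp
qed

lemma computable_add:
  assumes "computable n g" "computable n h" shows "computable n (\<lambda>xs. g xs + h xs)"
proof -
  let ?f = "PrimRec (Proj 0) (Comp Succ [Proj 1])"
  have "computes ?f [a, b] (a + b)" for a b
  proof (induction a)
    case 0
    show ?case using computes.proj[of 0 "[b]"] by (auto intro: computes.intros)
  next
    case (Suc a)
    have "computes (Comp Succ [Proj 1]) [a, a + b, b] (Suc (a + b))"
      using computes.proj[of 1 "[a, a + b, b]"]
      by (intro computes.comp[of _ _ "[a + b]"]) (auto intro: computes.intros)
    with Suc show ?case by (auto intro: computes.intros)
  qed
  then have "computable 2 (\<lambda>xs. xs ! 0 + xs ! 1)"
    unfolding computable_def by (intro exI[of _ ?f]) (auto simp: length_Suc_conv numeral_2_eq_2)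
  from computable_comp2[OF this assms] show ?thesis by simp
qed

lemma computable_prod_encode:
  assumes "computable n g" "computable n h"
  shows "computable n (\<lambda>xs. prod_encode (g xs, h xs))"
proof -
  \<comment> \<open>The pairing is a triangular number plus the first component, so one recursion
    suffices.\<close>
  have "triangle m = rec_nat 0 (\<lambda>k r. r + Suc k) m" for m
    by (induction m) simp_all
  then have eq: "(\<lambda>xs. prod_encode (g xs, h xs)) =
      (\<lambda>xs. rec_nat 0 (\<lambda>k r. r + Suc k) (g xs + h xs) + g xs)"
    by (simp add: prod_encode_def fun_eq_iff)
  show ?thesis
    unfolding eq
    by (intro computable_add computable_rec_nat computable_Suc computable_nth assms) simp_all
qed

section \<open>Codes of the instances\<close>

lemmas computable_intros = computable_const computable_Suc computable_prod_encode computable_add computable_nth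

text \<open>The tag is fixed, so the shape of the expression is constant and only the variable
  numbers \<open>vs\<close>, functions of the input, vary.\<close>

lemma computable_enc_eelt:
  assumes "\<And>v. v \<in> set vs \<Longrightarrow> computable n v"
  shows "computable n (\<lambda>xs. enc_expr (eelt t (map (\<lambda>v. v xs) vs)))"
proof -
  have epair: "computable n (\<lambda>xs. enc_expr (epair (e xs) (d xs)))"
    if "computable n (\<lambda>xs. enc_expr (e xs))" "computable n (\<lambda>xs. enc_expr (d xs))"
    for e d :: "nat list \<Rightarrow> expr"
    unfolding epair_def using that by (simp add: computable_intros)
  have "computable n (\<lambda>xs. enc_expr (foldr epair (map EVar (map (\<lambda>v. v xs) vs)) (EUnion [])))"
    using assms by (induction vs) (auto intro!: epair computable_intros)
  then have "computable n (\<lambda>xs. enc_expr (foldr epair (replicate m (EUnion []))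
      (foldr epair (map EVar (map (\<lambda>v. v xs) vs)) (EUnion []))))" for m
    by (induction m) (auto intro!: epair computable_intros)
  then show ?thesis by (simp add: eelt_def del: foldr_replicate)
qed

lemma computable_enc_singleton:
  assumes "\<And>v. v \<in> set vs \<Longrightarrow> computable n v"
  shows "computable n (\<lambda>xs. enc_builder (schema_builder [([], t, map (\<lambda>v. v xs) vs)]))"
  using computable_enc_eelt[OF assms] by (simp add: schema_builder_def computable_intros)

lemma computable_enc_fact:
  assumes "computable n g" shows "computable n (\<lambda>xs. enc_builder (schema_builder (fact_schema (g xs))))"
proof -
  have "computable n v" if "v \<in> set [\<lambda>xs. nvars + g xs, \<lambda>xs. nvars + Suc (g xs)]" for v
    using that assms by (auto intro!: computable_intros)
  from computable_enc_singleton[of "[\<lambda>xs. nvars + g xs, \<lambda>xs. nvars + Suc (g xs)]", OF this]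
  show ?thesis by (simp add: fact_schema_def)
qed

lemma computable_enc_goal:
  assumes "computable n g" shows "computable n (\<lambda>xs. enc_builder (schema_builder (goal_schema (g xs))))"
proof -
  have "computable n v" if "v \<in> set [\<lambda>xs. nvars + g xs]" for v
    using that assms by (auto intro!: computable_intros)
  from computable_enc_singleton[of "[\<lambda>xs. nvars + g xs]", OF this]
  show ?thesis by (simp add: goal_schema_def)
qed

text \<open>Only the goal, the chain of facts and the valuation depend on the input. The latter two
  grow at the front, so their codes arise by primitive recursion whose step is the code of cons,
  \<open>Suc (prod_encode (a, r))\<close>.\<close>

lemma computable_enc_inst: "computable 1 (\<lambda>xs. enc_instance (inst (xs ! 0)))"
proof -
  let ?B = "\<lambda>s. enc_builder (schema_builder s)"
  have facts: "list_encode (map ?B (facts k @ base)) =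
      rec_nat (list_encode (map ?B base)) (\<lambda>k r. Suc (prod_encode (?B (fact_schema k), r))) k" for k
    by (induction k) simp_all
  have val: "list_encode (map (\<lambda>(x, a). prod_encode (x, atom_index a)) (valuation k)) =
      rec_nat 0 (\<lambda>k r. Suc (prod_encode (prod_encode (nvars + k, k), r))) k" for k
    by (induction k) simp_all
  have "enc_presentation (fexpr ss, v) = prod_encode (prod_encode (1, list_encode (map ?B ss)),
      list_encode (map (\<lambda>(x, a). prod_encode (x, atom_index a)) v))" for ss v
    by (simp add: enc_presentation_def fexpr_def comp_def)
  then have enc: "enc_instance (inst x) = prod_encode (enc_presentation (pexpr base, []),
      prod_encode (prod_encode (1, Suc (prod_encode (?B (goal_schema x),
        list_encode (map ?B (facts (x + 5) @ base))))),
        list_encode (map (\<lambda>(x, a). prod_encode (x, atom_index a)) (valuation (x + 6)))))" for x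
    by (simp add: enc_instance_def inst_def schemas_def)
  show ?thesis
    unfolding enc facts val
    by (intro computable_intros computable_rec_nat computable_enc_fact computable_enc_goal) simp_all
qed

theorem theorem3p8:
  shows "\<not> decidable_on hitting_set_instances enc_instance has_hitting_set"
proof
  assume "decidable_on hitting_set_instances enc_instance has_hitting_set"
  then obtain f where f: "\<And>i. i \<in> hitting_set_instances \<Longrightarrow>
      computes f [enc_instance i] (if has_hitting_set i then 1 else 0)"
    unfolding decidable_on_def by blast
  obtain g where "\<And>xs. length xs = 1 \<Longrightarrow> computes g xs (enc_instance (inst (xs ! 0)))"
    using computable_enc_inst unfolding computable_def by blast
  from this[of "[x]" for x] have g: "computes g [x] (enc_instance (inst x))" for x by simp
  \<comment> \<open>On input \<open>x\<close>, \<open>d\<close> answers whether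
    \<open>inst x\<close> has a hitting set. For the code of \<open>d\<close> this holds iff
    \<open>d\<close> does not return 1, so answer 1 is refuted at once and answer 0 by
    determinism.\<close>
  define d where "d = Comp f [g]"
  have "list_all2 (\<lambda>h y. computes h [x] y) [g] [enc_instance (inst x)]" for x by (simp add: g)
  from computes.comp[OF this f[OF inst_mem]]
  have "computes d [enc_recf d] (if has_hitting_set (inst (enc_recf d)) then 1 else 0)"
    unfolding d_def .
  then show False
    using has_hitting_set_inst[of d] computes_deterministic by fastforce
qed

end
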